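(* Let $n\ge 1$ and $c_1<c_2<\cdots<c_n$ be real numbers. For $(x,y,z)\in\mathbb{R}^3$ put $\rho^2=x^2+y^2$, $r_j=\sqrt{x^2+y^2+(z-c_j)^2}$ and $V=\frac12\sum_{j=1}^n\frac1{r_j}$. On $U\times S^1$, where $U=\mathbb{R}^3\setminus\{(0,0,z): z\ge c_1\}$ and $e^{\sqrt{-1}\varphi}\in S^1$, let $$\alpha=-\frac12\sum_{j=1}^n\frac{x\,dy-y\,dx}{r_j(r_j-(z-c_j))},$$ $$g=\frac1V(d\varphi+\alpha)^2+V(dx^2+dy^2+dz^2),\qquad \omega=(d\varphi+\alpha)\wedge dz+V\,dx\wedge dy .$$ On the part where $\rho>0$, put $$z_1=\prod_{j=1}^n(r_j-(z-c_j))^{1/2}\cdot e^{\sqrt{-1}\varphi},\qquad z_2=x+\sqrt{-1}\,y .$$ Then the toric Gibbons-Hawking metric $g$ and its Kähler form $\omega$ are given in the complex coordinates $z_1,z_2$ by $$\begin{aligned} g&=\frac1V\frac{dz_1}{z_1}\frac{d\bar z_1}{\bar z_1}-\frac1{2V}\sum_{j=1}^n\frac{r_j+z-c_j}{r_j}\Bigl(\frac{dz_1}{z_1}\frac{d\bar z_2}{\bar z_2}+\frac{dz_2}{z_2}\frac{d\bar z_1}{\bar z_1}\Bigr)\\ &\quad+\Bigl[V\rho^2+\frac1{4V}\Bigl(\sum_{j=1}^n\frac{r_j+z-c_j}{r_j}\Bigr)^2\Bigr]\frac{dz_2}{z_2}\frac{d\bar z_2}{\bar z_2},\end{aligned}$$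 $$\begin{aligned} \omega&=\frac{1}{2\sqrt{-1}}\Bigl(\frac1V\frac{dz_1}{z_1}\wedge\frac{d\bar z_1}{\bar z_1}-\frac1{2V}\sum_{j=1}^n\frac{r_j+z-c_j}{r_j}\Bigl(\frac{dz_1}{z_1}\wedge\frac{d\bar z_2}{\bar z_2}+\frac{dz_2}{z_2}\wedge\frac{d\bar z_1}{\bar z_1}\Bigr)\\ &\quad+\Bigl[V\rho^2+\frac1{4V}\Bigl(\sum_{j=1}^n\frac{r_j+z-c_j}{r_j}\Bigr)^2\Bigr]\frac{dz_2}{z_2}\wedge\frac{d\bar z_2}{\bar z_2}\Bigr).\end{aligned}$$
   Context: Products of $1$-forms in $g$ are symmetric products (so $dw\,d\bar w=(d\,\mathrm{Re}\,w)^2+(d\,\mathrm{Im}\,w)^2$). The metric $g$ is the toric Gibbons-Hawking metric and $\omega$ is its Kähler form for the complex structure whose $(1,0)$-forms are spanned by $dx+\sqrt{-1}\,dy$ and $(d\varphi+\alpha)+\sqrt{-1}\,V\,dz$. Here $z$ (without subscript) is the third real coordinate on $\mathbb{R}^3$, not a complex coordinate.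
   Formalization: The prefactor 1/(2√-1) in the formula for ω is replaced by -1/(2√-1): since dz_2∧d\bar z_2 = -2√-1 dx∧dy, the printed right-hand side equals -ω at every point with ρ>0. *)

theory Defs
  imports "HOL-Analysis.Analysis"
begin

text \<open>
  The tuple \<open>(x, y, z, \<phi>)\<close> stands for the point \<open>((x, y, z), exp (\<i> \<phi>))\<close> of
  \<open>\<real>\<^sup>3 \<times> S\<^sup>1\<close>. Thus \<open>S\<^sup>1\<close> is described through its universal cover: all functions and
  tensors below are \<open>2\<pi>\<close>-periodic in \<open>\<phi>\<close>, tangent vectors of \<open>\<real>\<^sup>3 \<times> S\<^sup>1\<close> are quadruples of
  reals, and two tuples are the same point iff they are related by \<open>same_point\<close>.
\<close>

type_synonym pt = "real \<times> real \<times> real \<times> real"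

definition xc :: "pt \<Rightarrow> real" where "xc = (\<lambda>(x, y, z, \<phi>). x)"
definition yc :: "pt \<Rightarrow> real" where "yc = (\<lambda>(x, y, z, \<phi>). y)"
definition zc :: "pt \<Rightarrow> real" where "zc = (\<lambda>(x, y, z, \<phi>). z)"
definition phic :: "pt \<Rightarrow> real" where "phic = (\<lambda>(x, y, z, \<phi>). \<phi>)"

definition same_point :: "pt \<Rightarrow> pt \<Rightarrow> bool" where
  "same_point p q \<longleftrightarrow> xc p = xc q \<and> yc p = yc q \<and> zc p = zc q
     \<and> exp (\<i> * complex_of_real (phic p)) = exp (\<i> * complex_of_real (phic q))"

text \<open>Pointwise (real or complex) linear algebra of forms. The symmetric product is normalised so
  that the square of a 1-form \<open>a\<close> is \<open>a \<otimes> a\<close>.\<close>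

definition d :: "(pt \<Rightarrow> 'b::real_normed_vector) \<Rightarrow> pt \<Rightarrow> pt \<Rightarrow> 'b" where
  "d f p = frechet_derivative f (at p)"

definition dlog :: "(pt \<Rightarrow> complex) \<Rightarrow> pt \<Rightarrow> pt \<Rightarrow> complex" where
  "dlog f p v = d f p v / f p"

definition sym_prod :: "(pt \<Rightarrow> 'b::field) \<Rightarrow> (pt \<Rightarrow> 'b) \<Rightarrow> pt \<Rightarrow> pt \<Rightarrow> 'b" where
  "sym_prod a b u v = (a u * b v + a v * b u) / 2"

definition wedge :: "(pt \<Rightarrow> 'b::field) \<Rightarrow> (pt \<Rightarrow> 'b) \<Rightarrow> pt \<Rightarrow> pt \<Rightarrow> 'b" where
  "wedge a b u v = a u * b v - a v * b u"

definition gh_domain :: "(nat \<Rightarrow> real) \<Rightarrow> pt set" where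
  "gh_domain c = {p. \<not> (xc p = 0 \<and> yc p = 0 \<and> zc p \<ge> c 1)}"

definition rho :: "pt \<Rightarrow> real" where
  "rho p = sqrt ((xc p)\<^sup>2 + (yc p)\<^sup>2)"

definition rad :: "(nat \<Rightarrow> real) \<Rightarrow> nat \<Rightarrow> pt \<Rightarrow> real" where
  "rad c j p = sqrt ((xc p)\<^sup>2 + (yc p)\<^sup>2 + (zc p - c j)\<^sup>2)"

definition gh_V :: "nat \<Rightarrow> (nat \<Rightarrow> real) \<Rightarrow> pt \<Rightarrow> real" where
  "gh_V n c p = 1/2 * (\<Sum>j=1..n. 1 / rad c j p)"

definition gh_alpha :: "nat \<Rightarrow> (nat \<Rightarrow> real) \<Rightarrow> pt \<Rightarrow> pt \<Rightarrow> real" where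
  "gh_alpha n c p v = - (1/2) * (\<Sum>j=1..n.
     (xc p * d yc p v - yc p * d xc p v) / (rad c j p * (rad c j p - (zc p - c j))))"

definition gh_conn :: "nat \<Rightarrow> (nat \<Rightarrow> real) \<Rightarrow> pt \<Rightarrow> pt \<Rightarrow> real" where
  "gh_conn n c p v = d phic p v + gh_alpha n c p v"

definition gh_metric :: "nat \<Rightarrow> (nat \<Rightarrow> real) \<Rightarrow> pt \<Rightarrow> pt \<Rightarrow> pt \<Rightarrow> real" where
  "gh_metric n c p u v =
     1 / gh_V n c p * sym_prod (gh_conn n c p) (gh_conn n c p) u v
     + gh_V n c p * (sym_prod (d xc p) (d xc p) u v + sym_prod (d yc p) (d yc p) u v
                     + sym_prod (d zc p) (d zc p) u v)"

definition gh_omega :: "nat \<Rightarrow> (nat \<Rightarrow> real) \<Rightarrow> pt \<Rightarrow> pt \<Rightarrow> pt \<Rightarrow> real" where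
  "gh_omega n c p u v =
     wedge (gh_conn n c p) (d zc p) u v + gh_V n c p * wedge (d xc p) (d yc p) u v"

definition gh_10_forms :: "nat \<Rightarrow> (nat \<Rightarrow> real) \<Rightarrow> pt \<Rightarrow> (pt \<Rightarrow> complex) set" where
  "gh_10_forms n c p =
     {(\<lambda>v. a * (complex_of_real (d xc p v) + \<i> * complex_of_real (d yc p v))
         + b * (complex_of_real (gh_conn n c p v)
                + \<i> * complex_of_real (gh_V n c p) * complex_of_real (d zc p v))) | a b. True}"

text \<open>Complex coordinates on \<open>S\<close>: functions separating the points of \<open>S\<close> whose differentials
  span the (1,0)-forms at each point of \<open>S\<close>. As the space of (1,0)-forms has complex dimension 2,
  the two differentials are then a basis of it.\<close>

definition gh_complex_coords ::
  "nat \<Rightarrow> (nat \<Rightarrow> real) \<Rightarrow> pt set \<Rightarrow> (pt \<Rightarrow> complex) \<Rightarrow> (pt \<Rightarrow> complex) \<Rightarrow> bool" where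
  "gh_complex_coords n c S f\<^sub>1 f\<^sub>2 \<longleftrightarrow>
     (\<forall>p\<in>S. \<forall>q\<in>S. f\<^sub>1 p = f\<^sub>1 q \<and> f\<^sub>2 p = f\<^sub>2 q \<longrightarrow> same_point p q) \<and>
     (\<forall>p\<in>S. f\<^sub>1 differentiable (at p) \<and> f\<^sub>2 differentiable (at p) \<and>
        {(\<lambda>v. a * d f\<^sub>1 p v + b * d f\<^sub>2 p v) | a b. True} = gh_10_forms n c p)"

definition z1 :: "nat \<Rightarrow> (nat \<Rightarrow> real) \<Rightarrow> pt \<Rightarrow> complex" where
  "z1 n c p = complex_of_real (\<Prod>j=1..n. sqrt (rad c j p - (zc p - c j)))
              * exp (\<i> * complex_of_real (phic p))"

definition z2 :: "pt \<Rightarrow> complex" where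
  "z2 p = complex_of_real (xc p) + \<i> * complex_of_real (yc p)"

text \<open>Orientation: \<open>gh_omega\<close> is the form \<open>g(J\<cdot>,\<cdot>)\<close>, where the complex structure \<open>J\<close> acts on tangent
  vectors such that \<open>\<theta> \<circ> J = \<i> \<theta>\<close> for each (1,0)-form \<open>\<theta>\<close>. Since \<open>dw \<and> d(cnj w) = - 2 \<i> d(Re w) \<and> d(Im w)\<close>,
  the form \<open>g(J\<cdot>,\<cdot>)\<close> of a Hermitian \<open>g = \<Sum> h\<^sub>j\<^sub>k dw\<^sub>j d(cnj w\<^sub>k)\<close> is
  \<open>\<i>/2 = - 1/(2\<i>)\<close> times \<open>\<Sum> h\<^sub>j\<^sub>k dw\<^sub>j \<and> d(cnj w\<^sub>k)\<close>.\<close>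

lemma d_coords [simp]:
  "d xc p = xc" "d yc p = yc" "d zc p = zc" "d phic p = phic"
proof -
  have "(xc has_derivative xc) (at p)"
    unfolding xc_def case_prod_beta by (auto intro!: derivative_eq_intros)
  moreover have "(yc has_derivative yc) (at p)"
    unfolding yc_def case_prod_beta by (auto intro!: derivative_eq_intros)
  moreover have "(zc has_derivative zc) (at p)"
    unfolding zc_def case_prod_beta by (auto intro!: derivative_eq_intros)
  moreover have "(phic has_derivative phic) (at p)"
    unfolding phic_def case_prod_beta by (auto intro!: derivative_eq_intros)
  ultimately show "d xc p = xc" "d yc p = yc" "d zc p = zc" "d phic p = phic"
    unfolding d_def by (metis frechet_derivative_at)+
qed

lemma gh_omega_eq_metric_J:
  assumes V: "gh_V n c p \<noteq> 0"
    and J: "\<And>\<theta>. \<theta> \<in> gh_10_forms n c p \<Longrightarrow> \<theta> Ju = \<i> * \<theta> u"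
  shows "gh_omega n c p u v = gh_metric n c p Ju v"
proof -
  let ?V = "gh_V n c p" and ?A = "gh_conn n c p"
  have "(\<lambda>v. complex_of_real (xc v) + \<i> * complex_of_real (yc v)) \<in> gh_10_forms n c p"
    unfolding gh_10_forms_def by (rule CollectI, rule exI[of _ 1], rule exI[of _ 0]) simp
  from J[OF this] have xy: "xc Ju = - yc u" "yc Ju = xc u"
    by (auto simp: complex_eq_iff)
  have "(\<lambda>v. complex_of_real (?A v) + \<i> * complex_of_real ?V * complex_of_real (zc v))
          \<in> gh_10_forms n c p"
    unfolding gh_10_forms_def by (rule CollectI, rule exI[of _ 0], rule exI[of _ 1]) simp
  from J[OF this] have za: "?A Ju = - ?V * zc u" "?V * zc Ju = ?A u"
    by (auto simp: complex_eq_iff)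
  show ?thesis
    using V za(2) by (simp add: gh_omega_def gh_metric_def wedge_def sym_prod_def xy za(1) field_simps)
qed

end

theory Submission
  imports Defs
begin

text \<open>
  Write \<open>H = \<Sum>\<^sub>j (r\<^sub>j + z - c\<^sub>j) / r\<^sub>j\<close> and \<open>z\<^sub>2 = \<rho> exp (\<i> t)\<close>. The identity
  \<open>(r\<^sub>j - (z - c\<^sub>j)) (r\<^sub>j + (z - c\<^sub>j)) = \<rho>\<^sup>2\<close> clears the denominators \<open>r\<^sub>j - (z - c\<^sub>j)\<close> and brings
  both the connection form and \<open>d log \<bar>z\<^sub>1\<bar>\<close> into a common shape:
  \<open>\<alpha> = - (H/2) dt\<close> and \<open>d log \<bar>z\<^sub>1\<bar> = (H/2) d log \<rho> - V dz\<close>. Adding \<open>\<i> d\<phi>\<close> gives the one identity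
  from which everything follows (lemma \<open>dlog_z1\<close>):
  \<open>d log z\<^sub>1 = (H/2) d log z\<^sub>2 + \<i> (d\<phi> + \<alpha> + \<i> V dz)\<close>.

  It says that \<open>dz\<^sub>1, dz\<^sub>2\<close> and the two forms that define the complex structure are related by
  an invertible matrix, so they span the same space. It also says that
  \<open>\<epsilon> = d log z\<^sub>1 - (H/2) d log z\<^sub>2\<close> is \<open>\<i>\<close> times a form whose real and imaginary parts are
  \<open>d\<phi> + \<alpha>\<close> and \<open>V dz\<close>. The coefficients in the formulas for \<open>g\<close> and \<open>\<omega>\<close> are exactly
  what one gets by expanding \<open>\<epsilon> \<epsilon>'/V + V \<rho>\<^sup>2 (d log z\<^sub>2) (d log z\<^sub>2)'\<close>, a prime denoting
  the conjugate, so both formulas follow by completing the square.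

  The functions \<open>z\<^sub>1, z\<^sub>2\<close> separate points because \<open>\<bar>z\<^sub>1\<bar>\<close> is strictly decreasing in \<open>z\<close> when \<open>x\<close>
  and \<open>y\<close> are fixed, after which \<open>z\<^sub>1\<close> determines \<open>exp (\<i> \<phi>)\<close>.
\<close>

definition pole_sum :: "nat \<Rightarrow> (nat \<Rightarrow> real) \<Rightarrow> pt \<Rightarrow> real" where
  "pole_sum n c p = (\<Sum>j=1..n. (rad c j p + zc p - c j) / rad c j p)"

definition dlog_rho :: "pt \<Rightarrow> pt \<Rightarrow> real" where
  "dlog_rho p v = (xc p * xc v + yc p * yc v) / (rho p)\<^sup>2"

definition d_angle :: "pt \<Rightarrow> pt \<Rightarrow> real" where
  "d_angle p v = (xc p * yc v - yc p * xc v) / (rho p)\<^sup>2"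

section \<open>Distances to the poles off the axis\<close>

lemma rho_squared: "(rho p)\<^sup>2 = (xc p)\<^sup>2 + (yc p)\<^sup>2"
  by (simp add: rho_def)

lemma rad_squared: "(rad c j p)\<^sup>2 = (rho p)\<^sup>2 + (zc p - c j)\<^sup>2"
  by (simp add: rad_def rho_def)

lemma abs_height_less_rad:
  assumes "rho p > 0"
  shows "\<bar>zc p - c j\<bar> < rad c j p"
proof (rule power_less_imp_less_base)
  show "\<bar>zc p - c j\<bar>\<^sup>2 < (rad c j p)\<^sup>2"
    using assms by (simp add: rad_squared)
qed (simp add: rad_def)

lemma rad_pos: "rho p > 0 \<Longrightarrow> rad c j p > 0"
  using abs_height_less_rad[of p c j] by linarith

lemma gap_pos: "rho p > 0 \<Longrightarrow> rad c j p - (zc p - c j) > 0"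
  using abs_height_less_rad[of p c j] by linarith

lemma gap_times_cogap:
  "(rad c j p - (zc p - c j)) * (rad c j p + zc p - c j) = (rho p)\<^sup>2"
  using rad_squared[of c j p] by (simp add: algebra_simps power2_eq_square)

text \<open>The denominators in \<open>\<alpha>\<close> and in \<open>d log (r\<^sub>j - (z - c\<^sub>j))\<close> are all of this form; replacing
  them by \<open>\<rho>\<^sup>2\<close> lets the sums over the poles be collected into \<open>H\<close>.\<close>

lemma inverse_gap:
  assumes "rho p > 0"
  shows "1 / (rad c j p - (zc p - c j)) = (rad c j p + zc p - c j) / (rho p)\<^sup>2"
proof -
  have "rad c j p - (zc p - c j) \<noteq> 0" "(rho p)\<^sup>2 \<noteq> 0"
    using gap_pos[OF assms, of c j] assms by auto
  then show ?thesis
    using gap_times_cogap[of c j p] by (simp add: divide_eq_eq eq_divide_eq mult.commute)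
qed

lemma gh_V_pos:
  assumes "n \<ge> 1" "rho p > 0"
  shows "gh_V n c p > 0"
  unfolding gh_V_def using assms by (auto intro!: sum_pos simp: rad_pos)

text \<open>This is \<open>\<alpha> = - (H/2) dt\<close>, with \<open>t\<close> the argument of \<open>z\<^sub>2\<close>.\<close>

lemma gh_conn_eq:
  assumes "rho p > 0"
  shows "gh_conn n c p v = phic v - pole_sum n c p / 2 * d_angle p v"
proof -
  have "(xc p * yc v - yc p * xc v) / (rad c j p * (rad c j p - (zc p - c j)))
      = (rad c j p + zc p - c j) / rad c j p * d_angle p v" for j
  proof -
    have "(xc p * yc v - yc p * xc v) / (rad c j p * (rad c j p - (zc p - c j)))
        = (xc p * yc v - yc p * xc v) / rad c j p * (1 / (rad c j p - (zc p - c j)))"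
      by simp
    then show ?thesis
      by (simp only: inverse_gap[OF assms]) (simp add: d_angle_def)
  qed
  then show ?thesis
    by (simp add: gh_conn_def gh_alpha_def pole_sum_def sum_distrib_right)
qed

section \<open>Logarithmic differentials of the coordinates\<close>

lemma has_derivative_coords:
  "(xc has_derivative xc) F" "(yc has_derivative yc) F"
  "(zc has_derivative zc) F" "(phic has_derivative phic) F"
  unfolding xc_def yc_def zc_def phic_def case_prod_beta
  by (auto intro!: derivative_eq_intros)

lemma has_derivative_prod_log:
  fixes f :: "'i \<Rightarrow> 'a::real_normed_vector \<Rightarrow> real"
  assumes "finite I"
    and "\<And>i. i \<in> I \<Longrightarrow> (f i has_derivative (\<lambda>v. f i p * l i v)) (at p)"
  shows "((\<lambda>q. \<Prod>i\<in>I. f i q) has_derivative (\<lambda>v. (\<Prod>i\<in>I. f i p) * (\<Sum>i\<in>I. l i v))) (at p)"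
  using assms
proof (induction I rule: finite_induct)
  case empty
  then show ?case by simp
next
  case (insert i I)
  have "((\<lambda>q. f i q * (\<Prod>i\<in>I. f i q)) has_derivative
      (\<lambda>v. f i p * ((\<Prod>i\<in>I. f i p) * (\<Sum>i\<in>I. l i v)) + f i p * l i v * (\<Prod>i\<in>I. f i p))) (at p)"
    using insert by (intro has_derivative_mult) auto
  then show ?case
    using insert.hyps by (simp add: algebra_simps)
qed

lemma has_derivative_rad:
  assumes "rho p > 0"
  shows "(rad c j has_derivative
    (\<lambda>v. (xc p * xc v + yc p * yc v + (zc p - c j) * zc v) / rad c j p)) (at p)"
proof -
  have "(xc p)\<^sup>2 + (yc p)\<^sup>2 + (zc p - c j)\<^sup>2 > 0"
    using rad_pos[OF assms, of c j] by (simp add: rad_def)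
  then have "((\<lambda>q. sqrt ((xc q)\<^sup>2 + (yc q)\<^sup>2 + (zc q - c j)\<^sup>2)) has_derivative
    (\<lambda>v. (xc p * xc v + yc p * yc v + (zc p - c j) * zc v)
         / sqrt ((xc p)\<^sup>2 + (yc p)\<^sup>2 + (zc p - c j)\<^sup>2))) (at p)"
    by (auto intro!: derivative_eq_intros has_derivative_coords simp: field_simps)
  then show ?thesis
    by (simp add: rad_def[abs_def])
qed

text \<open>Differentiating \<open>r\<^sub>j - (z - c\<^sub>j)\<close> reproduces this function as a factor of \<open>dz\<close>, and the
  remaining radial term loses its denominator by \<open>inverse_gap\<close>.\<close>

lemma has_derivative_sqrt_gap:
  assumes "rho p > 0"
  shows "((\<lambda>q. sqrt (rad c j q - (zc q - c j))) has_derivative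
    (\<lambda>v. sqrt (rad c j p - (zc p - c j)) *
      ((rad c j p + zc p - c j) / rad c j p / 2 * dlog_rho p v - 1 / rad c j p / 2 * zc v))) (at p)"
proof -
  let ?r = "rad c j p" and ?s = "zc p - c j"
  have r: "?r > 0" and g: "?r - ?s > 0"
    using rad_pos[OF assms] gap_pos[OF assms] by auto
  let ?w = "\<lambda>v. xc p * xc v + yc p * yc v"
  have "((\<lambda>q. rad c j q - (zc q - c j)) has_derivative
      (\<lambda>v. (?w v + ?s * zc v) / ?r - (zc v - 0))) (at p)"
    by (intro has_derivative_diff has_derivative_rad assms has_derivative_coords has_derivative_const)
  from has_derivative_real_sqrt[OF g this]
  have "((\<lambda>q. sqrt (rad c j q - (zc q - c j))) has_derivative
      (\<lambda>v. ((?w v + ?s * zc v) / ?r - (zc v - 0)) * (inverse (sqrt (?r - ?s)) / 2))) (at p)" .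
  moreover have "((?w v + ?s * zc v) / ?r - (zc v - 0)) * (inverse (sqrt (?r - ?s)) / 2)
      = sqrt (?r - ?s) * ((?r + zc p - c j) / ?r / 2 * dlog_rho p v - 1 / ?r / 2 * zc v)" for v
  proof -
    \<comment> \<open>The bracket has \<open>r - s\<close> as a factor, of which the chain rule for the square root keeps
      \<open>sqrt (r - s)\<close>; this is why the derivative is a multiple of the function.\<close>
    have split: "(w + s * t) / r - (t - 0) = (r - s) * (w / r * (1 / (r - s)) - 1 / r * t)"
      if "r > 0" "r - s > 0" for w s t r :: real
      using that by (simp add: field_simps)
    have cancel: "(g * (a * w - b * t)) * (inverse (sqrt g) / 2) = sqrt g * (a / 2 * w - b / 2 * t)"
      if "g > 0" for g a w b t :: real
    proof -
      have "g * inverse (sqrt g) = sqrt g"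
        using that by (simp add: real_div_sqrt flip: divide_inverse)
      then have "sqrt g * (a / 2 * w - b / 2 * t) = g * inverse (sqrt g) * ((a * w - b * t) / 2)"
        by (simp add: diff_divide_distrib)
      then show ?thesis by simp
    qed
    have "?w v / ?r * (1 / (?r - ?s)) = (?r + zc p - c j) / ?r * dlog_rho p v"
      by (simp only: inverse_gap[OF assms]) (simp add: dlog_rho_def)
    then show ?thesis
      by (simp only: split[OF r g] cancel[OF g])
  qed
  ultimately show ?thesis by (simp only:)
qed

text \<open>Summing the logarithmic differentials of the factors gives \<open>(H/2) d log \<rho> - V dz\<close> for the
  modulus, since the coefficients of \<open>dz\<close> add up to \<open>- V\<close>.\<close>

lemma has_derivative_z1:
  assumes "rho p > 0"
  shows "(z1 n c has_derivative (\<lambda>v. z1 n c p *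
    (complex_of_real (pole_sum n c p / 2 * dlog_rho p v - gh_V n c p * zc v)
     + \<i> * complex_of_real (phic v)))) (at p)"
proof -
  let ?P = "\<lambda>q. \<Prod>j=1..n. sqrt (rad c j q - (zc q - c j))"
  let ?L = "\<lambda>v. \<Sum>j=1..n.
      (rad c j p + zc p - c j) / rad c j p / 2 * dlog_rho p v - 1 / rad c j p / 2 * zc v"
  have "(?P has_derivative (\<lambda>v. ?P p * ?L v)) (at p)"
    by (intro has_derivative_prod_log has_derivative_sqrt_gap assms) simp
  then have P: "((\<lambda>q. complex_of_real (?P q)) has_derivative
      (\<lambda>v. complex_of_real (?P p * ?L v))) (at p)"
    by (rule has_derivative_of_real)
  have "((\<lambda>q. \<i> * complex_of_real (phic q)) has_derivative (\<lambda>v. \<i> * complex_of_real (phic v))) (at p)"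
    by (intro has_derivative_mult_right has_derivative_of_real has_derivative_coords)
  from has_derivative_compose[OF this DERIV_exp[unfolded has_field_derivative_def]]
  have "((\<lambda>q. exp (\<i> * complex_of_real (phic q))) has_derivative
      (\<lambda>v. exp (\<i> * complex_of_real (phic p)) * (\<i> * complex_of_real (phic v)))) (at p)" .
  from has_derivative_mult[OF P this]
  have "(z1 n c has_derivative (\<lambda>v. z1 n c p *
      (complex_of_real (?L v) + \<i> * complex_of_real (phic v)))) (at p)"
    unfolding z1_def[abs_def]
    by (rule has_derivative_eq_rhs) (simp only: of_real_mult, simp add: algebra_simps)
  moreover have "?L v = pole_sum n c p / 2 * dlog_rho p v - gh_V n c p * zc v" for v
    by (simp only: sum_subtractf sum_distrib_right[symmetric] sum_divide_distrib[symmetric])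
      (simp add: pole_sum_def gh_V_def)
  ultimately show ?thesis by (simp only:)
qed

lemma has_derivative_z2: "(z2 has_derivative z2) F"
  unfolding z2_def[abs_def]
  by (intro has_derivative_add has_derivative_mult_right has_derivative_of_real has_derivative_coords)

lemma norm_z1:
  assumes "rho p > 0"
  shows "cmod (z1 n c p) = (\<Prod>j=1..n. sqrt (rad c j p - (zc p - c j)))"
proof -
  have "(\<Prod>j=1..n. sqrt (rad c j p - (zc p - c j))) > 0"
    using gap_pos[OF assms] by (intro prod_pos) simp
  then show ?thesis
    by (simp add: z1_def norm_mult del: of_real_prod)
qed

lemma z1_nonzero:
  assumes "rho p > 0"
  shows "z1 n c p \<noteq> 0"
proof -
  have "(\<Prod>j=1..n. sqrt (rad c j p - (zc p - c j))) > 0"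
    using gap_pos[OF assms] by (intro prod_pos) simp
  then have "cmod (z1 n c p) > 0"
    by (simp only: norm_z1[OF assms])
  then show ?thesis by simp
qed

lemma norm_z2: "cmod (z2 p) = rho p"
  by (simp add: z2_def rho_def cmod_def)

lemma dlog_cnj:
  assumes "f differentiable (at p)"
  shows "dlog (\<lambda>q. cnj (f q)) p v = cnj (dlog f p v)"
proof -
  have "(f has_derivative d f p) (at p)"
    using assms unfolding d_def by (simp add: frechet_derivative_works)
  then have "d (\<lambda>q. cnj (f q)) p = (\<lambda>v. cnj (d f p v))"
    unfolding d_def[of "\<lambda>q. cnj (f q)"] by (intro frechet_derivative_at[symmetric] has_derivative_cnj)
  then show ?thesis
    by (simp add: dlog_def)
qed

lemma d_z2: "d z2 p = z2"
  unfolding d_def by (rule frechet_derivative_at[OF has_derivative_z2, symmetric])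

lemma dlog_z2:
  assumes "rho p > 0"
  shows "dlog z2 p v = complex_of_real (dlog_rho p v) + \<i> * complex_of_real (d_angle p v)"
proof -
  have "z2 p * (complex_of_real (dlog_rho p v) + \<i> * complex_of_real (d_angle p v))
      = z2 v * complex_of_real (((xc p)\<^sup>2 + (yc p)\<^sup>2) / (rho p)\<^sup>2)"
    by (simp add: complex_eq_iff z2_def dlog_rho_def d_angle_def)
      (simp add: power2_eq_square field_simps flip: add_divide_distrib diff_divide_distrib)
  also have "\<dots> = z2 v"
    using assms by (simp flip: rho_squared)
  finally have "z2 v = z2 p * (complex_of_real (dlog_rho p v) + \<i> * complex_of_real (d_angle p v))"
    by simp
  moreover have "z2 p \<noteq> 0"
    using assms norm_z2[of p] by auto
  ultimately show ?thesis
    by (simp add: dlog_def d_z2)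
qed

text \<open>The identity behind the theorem. Multiplying \<open>d log z\<^sub>2 = d log \<rho> + \<i> dt\<close> by \<open>H/2\<close>
  accounts for the radial part of \<open>d log \<bar>z\<^sub>1\<bar>\<close>, and the angular part this introduces is exactly
  the one that \<open>\<alpha>\<close> removes again.\<close>

lemma dlog_z1:
  assumes "rho p > 0"
  shows "dlog (z1 n c) p v = complex_of_real (pole_sum n c p) / 2 * dlog z2 p v
    + \<i> * (complex_of_real (gh_conn n c p v)
           + \<i> * complex_of_real (gh_V n c p) * complex_of_real (zc v))"
proof -
  have "dlog (z1 n c) p v =
      complex_of_real (pole_sum n c p / 2 * dlog_rho p v - gh_V n c p * zc v)
      + \<i> * complex_of_real (phic v)"
    unfolding dlog_def d_def frechet_derivative_at[OF has_derivative_z1[OF assms, of n c], symmetric]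
    using z1_nonzero[OF assms, of n c] by simp
  then show ?thesis
    by (simp add: dlog_z2[OF assms] gh_conn_eq[OF assms] complex_eq_iff)
qed

section \<open>The coordinate system\<close>

text \<open>As \<open>r\<^sub>j\<^sup>2 - (z - c\<^sub>j)\<^sup>2\<close> depends on \<open>\<rho>\<close> only, the increments of \<open>r\<^sub>j\<close> and of \<open>z\<close> between
  two points with equal \<open>\<rho>\<close> are related by a difference of squares, and \<open>\<bar>z - c\<^sub>j\<bar> < r\<^sub>j\<close> makes
  the increment of \<open>r\<^sub>j\<close> the smaller one.\<close>

lemma gap_strict_antimono:
  assumes "rho p > 0" "rho q = rho p" "zc p < zc q"
  shows "rad c j q - (zc q - c j) < rad c j p - (zc p - c j)"
proof -
  let ?s = "zc p - c j" and ?t = "zc q - c j"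
  have p: "\<bar>?s\<bar> < rad c j p" and q: "\<bar>?t\<bar> < rad c j q"
    using assms abs_height_less_rad by auto
  have "(rad c j q)\<^sup>2 - (rad c j p)\<^sup>2 = ?t\<^sup>2 - ?s\<^sup>2"
    using assms(2) by (simp add: rad_squared)
  then have "(rad c j q - rad c j p) * (rad c j q + rad c j p) = (?t - ?s) * (?t + ?s)"
    by (simp add: algebra_simps power2_eq_square)
  also have "\<dots> < (?t - ?s) * (rad c j q + rad c j p)"
    using assms(3) p q by (intro mult_strict_left_mono) auto
  finally have "rad c j q - rad c j p < ?t - ?s"
    using p q by (simp add: mult_less_cancel_right)
  then show ?thesis by simp
qed

lemma norm_z1_strict_antimono:
  assumes "n \<ge> 1" "rho p > 0" "rho q = rho p" "zc p < zc q"
  shows "cmod (z1 n c q) < cmod (z1 n c p)"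
proof -
  have "rho q > 0" using assms by simp
  have "(\<Prod>j=1..n. sqrt (rad c j q - (zc q - c j))) < (\<Prod>j=1..n. sqrt (rad c j p - (zc p - c j)))"
  proof (rule prod_mono_strict[of 1])
    show "sqrt (rad c 1 q - (zc q - c 1)) < sqrt (rad c 1 p - (zc p - c 1))"
      using gap_strict_antimono[OF assms(2-4)] by simp
  next
    fix j
    show "0 \<le> sqrt (rad c j q - (zc q - c j)) \<and>
        sqrt (rad c j q - (zc q - c j)) \<le> sqrt (rad c j p - (zc p - c j))"
      using gap_strict_antimono[OF assms(2-4), of c j] gap_pos[OF \<open>rho q > 0\<close>, of c j] by simp
    show "0 < sqrt (rad c j p - (zc p - c j))"
      using gap_pos[OF assms(2)] by simp
  qed (use assms in auto)
  then show ?thesis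
    using assms by (simp add: norm_z1)
qed

text \<open>\<open>z\<^sub>2\<close> determines \<open>x\<close> and \<open>y\<close>, after which \<open>\<bar>z\<^sub>1\<bar>\<close> determines \<open>z\<close> by monotonicity and the
  remaining unit factor of \<open>z\<^sub>1\<close> is \<open>exp (\<i> \<phi>)\<close>.\<close>

lemma z1_z2_separate_points:
  assumes "n \<ge> 1" "rho p > 0" "z1 n c p = z1 n c q" "z2 p = z2 q"
  shows "same_point p q"
proof -
  have xy: "xc p = xc q" "yc p = yc q"
    using assms(4) by (auto simp: z2_def complex_eq_iff)
  then have rho: "rho q = rho p"
    by (simp add: rho_def)
  have "zc p = zc q"
  proof (rule ccontr)
    assume "zc p \<noteq> zc q"
    then consider "zc p < zc q" | "zc q < zc p" by linarith
    then have "cmod (z1 n c p) \<noteq> cmod (z1 n c q)"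
    proof cases
      case 1
      from norm_z1_strict_antimono[OF assms(1,2) rho this, of c] show ?thesis by simp
    next
      case 2
      from norm_z1_strict_antimono[OF assms(1) _ rho[symmetric] this, of c] assms(2) rho
      show ?thesis by simp
    qed
    with assms(3) show False by simp
  qed
  moreover from this have "rad c j p = rad c j q" for j
    by (simp add: rad_def xy)
  ultimately have "z1 n c q = cmod (z1 n c q) * exp (\<i> * complex_of_real (phic q))"
    and "z1 n c p = cmod (z1 n c q) * exp (\<i> * complex_of_real (phic p))"
    using assms rho norm_z1[of q n c] by (simp_all add: z1_def)
  then have "cmod (z1 n c q) * exp (\<i> * complex_of_real (phic p))
      = cmod (z1 n c q) * exp (\<i> * complex_of_real (phic q))"
    using assms(3) by simp
  moreover have "cmod (z1 n c q) \<noteq> 0"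
    using z1_nonzero[of q n c] assms rho by simp
  ultimately show ?thesis
    using xy \<open>zc p = zc q\<close> by (simp add: same_point_def)
qed

lemma span_pair_triangular:
  fixes f g e :: "'a \<Rightarrow> 'b::field"
  assumes "\<And>v. f v = m * g v + k * e v" and "k \<noteq> 0"
  shows "{(\<lambda>v. a * f v + b * g v) | a b. True} = {(\<lambda>v. a * g v + b * e v) | a b. True}"
proof (intro set_eqI iffI)
  fix h assume "h \<in> {(\<lambda>v. a * f v + b * g v) | a b. True}"
  then obtain a b where "h = (\<lambda>v. a * f v + b * g v)" by blast
  then have "h = (\<lambda>v. (a * m + b) * g v + (a * k) * e v)"
    by (simp add: assms(1) algebra_simps)
  then show "h \<in> {(\<lambda>v. a * g v + b * e v) | a b. True}" by blast
next
  fix h assume "h \<in> {(\<lambda>v. a * g v + b * e v) | a b. True}"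
  then obtain a b where "h = (\<lambda>v. a * g v + b * e v)" by blast
  then have "h = (\<lambda>v. (b / k) * f v + (a - b / k * m) * g v)"
    using assms(2) by (simp add: assms(1) algebra_simps)
  then show "h \<in> {(\<lambda>v. a * f v + b * g v) | a b. True}" by blast
qed

text \<open>By \<open>dlog_z1\<close>, passing from the frame \<open>dz\<^sub>2, d\<phi> + \<alpha> + \<i> V dz\<close> to \<open>dz\<^sub>1, dz\<^sub>2\<close> is a triangular
  change of basis whose decisive coefficient is \<open>\<i> z\<^sub>1 \<noteq> 0\<close>.\<close>

lemma span_dz1_dz2:
  assumes "rho p > 0"
  shows "{(\<lambda>v. a * d (z1 n c) p v + b * d z2 p v) | a b. True} = gh_10_forms n c p"
proof -
  let ?e = "\<lambda>v. complex_of_real (gh_conn n c p v)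
    + \<i> * complex_of_real (gh_V n c p) * complex_of_real (zc v)"
  have "d (z1 n c) p v
      = (z1 n c p * complex_of_real (pole_sum n c p) / (2 * z2 p)) * z2 v + (\<i> * z1 n c p) * ?e v"
    for v
  proof -
    have "d (z1 n c) p v = z1 n c p * dlog (z1 n c) p v"
      using z1_nonzero[OF assms] by (simp add: dlog_def)
    then show ?thesis
      unfolding dlog_z1[OF assms] by (simp add: dlog_def d_z2 algebra_simps)
  qed
  then have "{(\<lambda>v. a * d (z1 n c) p v + b * z2 v) | a b. True}
      = {(\<lambda>v. a * z2 v + b * ?e v) | a b. True}"
    by (rule span_pair_triangular) (simp add: z1_nonzero[OF assms])
  then show ?thesis
    by (simp only: d_z2 gh_10_forms_def d_coords) (simp only: z2_def)
qed

lemma z1_z2_complex_coords: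
  assumes "n \<ge> 1" and "\<And>p. p \<in> S \<Longrightarrow> rho p > 0"
  shows "gh_complex_coords n c S (z1 n c) z2"
  unfolding gh_complex_coords_def
  using assms z1_z2_separate_points span_dz1_dz2 has_derivative_z1 has_derivative_z2
  by (simp add: differentiable_def) blast

section \<open>Completing the square\<close>

text \<open>With \<open>a = d log z\<^sub>1\<close>, \<open>b = d log z\<^sub>2\<close> and the primed forms their conjugates, the left-hand
  side is the coordinate expression of the theorem for \<open>W = V \<rho>\<^sup>2\<close>. Only bilinearity in an unprimed
  and a primed form enters, so the symmetric product and the wedge product behave alike.\<close>

lemma sym_prod_complete_square:
  fixes a a' b b' :: "pt \<Rightarrow> complex"
  shows "1 / V * sym_prod a a' u v
      - 1 / (2 * V) * H * (sym_prod a b' u v + sym_prod b a' u v)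
      + (W + 1 / (4 * V) * H\<^sup>2) * sym_prod b b' u v
    = 1 / V * sym_prod (\<lambda>v. a v - H / 2 * b v) (\<lambda>v. a' v - H / 2 * b' v) u v
      + W * sym_prod b b' u v"
  unfolding sym_prod_def
  by (cases "V = 0") (simp_all add: field_simps power2_eq_square)

lemma wedge_complete_square:
  fixes a a' b b' :: "pt \<Rightarrow> complex"
  shows "1 / V * wedge a a' u v
      - 1 / (2 * V) * H * (wedge a b' u v + wedge b a' u v)
      + (W + 1 / (4 * V) * H\<^sup>2) * wedge b b' u v
    = 1 / V * wedge (\<lambda>v. a v - H / 2 * b v) (\<lambda>v. a' v - H / 2 * b' v) u v
      + W * wedge b b' u v"
  unfolding wedge_def
  by (cases "V = 0") (simp_all add: field_simps power2_eq_square)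

lemma sym_prod_complex_conjugate:
  fixes a b :: "pt \<Rightarrow> real"
  shows "sym_prod (\<lambda>v. complex_of_real (a v) + \<i> * complex_of_real (b v))
      (\<lambda>v. cnj (complex_of_real (a v) + \<i> * complex_of_real (b v))) u v
    = complex_of_real (sym_prod a a u v + sym_prod b b u v)"
  by (simp add: sym_prod_def complex_eq_iff)

text \<open>The factor \<open>- 2 \<i>\<close> is what the normalisation \<open>- 1 / (2 \<i>)\<close> of the Kaehler form
  cancels.\<close>

lemma wedge_complex_conjugate:
  fixes a b :: "pt \<Rightarrow> real"
  shows "wedge (\<lambda>v. complex_of_real (a v) + \<i> * complex_of_real (b v))
      (\<lambda>v. cnj (complex_of_real (a v) + \<i> * complex_of_real (b v))) u v
    = - 2 * \<i> * complex_of_real (wedge a b u v)"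
  by (simp add: wedge_def complex_eq_iff)

text \<open>The factor \<open>\<rho>\<^sup>2\<close> cancels the denominator \<open>z\<^sub>2 cnj z\<^sub>2\<close> of the logarithmic forms, so the second
  square contributes \<open>V (dx\<^sup>2 + dy\<^sup>2)\<close> to \<open>g\<close> and \<open>V dx \<and> dy\<close> to \<open>\<omega>\<close>.\<close>

lemma z2_products:
  assumes "rho p > 0"
  shows "(complex_of_real (rho p))\<^sup>2 * sym_prod (dlog z2 p) (dlog (\<lambda>q. cnj (z2 q)) p) u v
      = complex_of_real (sym_prod xc xc u v + sym_prod yc yc u v)"
    and "(complex_of_real (rho p))\<^sup>2 * wedge (dlog z2 p) (dlog (\<lambda>q. cnj (z2 q)) p) u v
      = - 2 * \<i> * complex_of_real (wedge xc yc u v)"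
proof -
  have d: "dlog z2 p = (\<lambda>v. z2 v / z2 p)"
    by (simp add: dlog_def[abs_def] d_z2)
  have d': "dlog (\<lambda>q. cnj (z2 q)) p = (\<lambda>v. cnj (z2 v) / cnj (z2 p))"
  proof
    fix v
    have "z2 differentiable (at p)"
      using has_derivative_z2 by (auto simp: differentiable_def)
    then show "dlog (\<lambda>q. cnj (z2 q)) p v = cnj (z2 v) / cnj (z2 p)"
      by (simp add: dlog_cnj d)
  qed
  have N: "(complex_of_real (rho p))\<^sup>2 = z2 p * cnj (z2 p)"
    by (simp add: complex_norm_square[symmetric] norm_z2 flip: of_real_power)
  have "z2 p \<noteq> 0"
    using assms norm_z2[of p] by auto
  then have "(complex_of_real (rho p))\<^sup>2 * sym_prod (dlog z2 p) (dlog (\<lambda>q. cnj (z2 q)) p) u v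
      = sym_prod z2 (\<lambda>v. cnj (z2 v)) u v"
    and "(complex_of_real (rho p))\<^sup>2 * wedge (dlog z2 p) (dlog (\<lambda>q. cnj (z2 q)) p) u v
      = wedge z2 (\<lambda>v. cnj (z2 v)) u v"
    unfolding d d' N by (simp_all add: sym_prod_def wedge_def field_simps)
  then show "(complex_of_real (rho p))\<^sup>2 * sym_prod (dlog z2 p) (dlog (\<lambda>q. cnj (z2 q)) p) u v
      = complex_of_real (sym_prod xc xc u v + sym_prod yc yc u v)"
    and "(complex_of_real (rho p))\<^sup>2 * wedge (dlog z2 p) (dlog (\<lambda>q. cnj (z2 q)) p) u v
      = - 2 * \<i> * complex_of_real (wedge xc yc u v)"
    using sym_prod_complex_conjugate[of xc yc u v] wedge_complex_conjugate[of xc yc u v]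
    by (simp_all add: z2_def[abs_def])
qed

text \<open>The first square contributes the terms along \<open>dz\<close> and \<open>d\<phi> + \<alpha>\<close>: the factor \<open>\<i>\<close> in
  \<open>dlog_z1\<close> makes \<open>- V dz\<close> the real part and \<open>d\<phi> + \<alpha>\<close> the imaginary part of \<open>\<epsilon>\<close>.\<close>

lemma z1_remainder_products:
  fixes c :: "nat \<Rightarrow> real"
  assumes "n \<ge> 1" "rho p > 0"
  defines "V \<equiv> complex_of_real (gh_V n c p)" and "H \<equiv> complex_of_real (pole_sum n c p)"
  defines "\<epsilon> \<equiv> (\<lambda>v. dlog (z1 n c) p v - H / 2 * dlog z2 p v)"
    and "\<epsilon>' \<equiv> (\<lambda>v. dlog (\<lambda>q. cnj (z1 n c q)) p v - H / 2 * dlog (\<lambda>q. cnj (z2 q)) p v)"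
  shows "1 / V * sym_prod \<epsilon> \<epsilon>' u v = complex_of_real
      (1 / gh_V n c p * sym_prod (gh_conn n c p) (gh_conn n c p) u v
       + gh_V n c p * sym_prod zc zc u v)"
    and "1 / V * wedge \<epsilon> \<epsilon>' u v = - 2 * \<i> * complex_of_real (wedge (gh_conn n c p) zc u v)"
proof -
  have V: "gh_V n c p \<noteq> 0"
    using gh_V_pos[OF assms(1,2), of c] by simp
  have e: "\<epsilon> = (\<lambda>v. complex_of_real (- gh_V n c p * zc v)
      + \<i> * complex_of_real (gh_conn n c p v))"
    by (rule ext) (simp add: \<epsilon>_def H_def dlog_z1[OF assms(2)] complex_eq_iff)
  have "z1 n c differentiable (at p)" "z2 differentiable (at p)"
    using has_derivative_z1[OF assms(2)] has_derivative_z2 by (auto simp: differentiable_def)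
  then have "\<epsilon>' = (\<lambda>v. cnj (\<epsilon> v))"
    by (simp add: \<epsilon>_def \<epsilon>'_def H_def dlog_cnj)
  then have e': "\<epsilon>' = (\<lambda>v. cnj (complex_of_real (- gh_V n c p * zc v)
      + \<i> * complex_of_real (gh_conn n c p v)))"
    by (simp only: e)
  have "sym_prod \<epsilon> \<epsilon>' u v = complex_of_real
      (sym_prod (\<lambda>v. - gh_V n c p * zc v) (\<lambda>v. - gh_V n c p * zc v) u v
       + sym_prod (gh_conn n c p) (gh_conn n c p) u v)"
    and "wedge \<epsilon> \<epsilon>' u v
      = - 2 * \<i> * complex_of_real (wedge (\<lambda>v. - gh_V n c p * zc v) (gh_conn n c p) u v)"
    unfolding e e' by (rule sym_prod_complex_conjugate, rule wedge_complex_conjugate)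
  moreover have "sym_prod (\<lambda>v. - gh_V n c p * zc v) (\<lambda>v. - gh_V n c p * zc v) u v
      = (gh_V n c p)\<^sup>2 * sym_prod zc zc u v"
    by (simp add: sym_prod_def power2_eq_square algebra_simps)
  moreover have "wedge (\<lambda>v. - gh_V n c p * zc v) (gh_conn n c p) u v
      = gh_V n c p * wedge (gh_conn n c p) zc u v"
    by (simp add: wedge_def algebra_simps)
  ultimately show "1 / V * sym_prod \<epsilon> \<epsilon>' u v = complex_of_real
      (1 / gh_V n c p * sym_prod (gh_conn n c p) (gh_conn n c p) u v
       + gh_V n c p * sym_prod zc zc u v)"
    and "1 / V * wedge \<epsilon> \<epsilon>' u v = - 2 * \<i> * complex_of_real (wedge (gh_conn n c p) zc u v)"
    using V by (simp_all add: V_def field_simps power2_eq_square)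
qed

theorem theorem4p1:
  fixes n :: nat and c :: "nat \<Rightarrow> real"
  assumes "n \<ge> 1"
    and "strict_mono_on {1..n} c"
  shows "gh_complex_coords n c {p \<in> gh_domain c. rho p > 0} (z1 n c) z2 \<and>
    (\<forall>p \<in> gh_domain c. rho p > 0 \<longrightarrow>
      (let V = complex_of_real (gh_V n c p);
           H = complex_of_real (\<Sum>j=1..n. (rad c j p + zc p - c j) / rad c j p);
           \<rho> = complex_of_real (rho p);
           \<zeta>\<^sub>1 = dlog (z1 n c) p; \<zeta>\<^sub>1' = dlog (\<lambda>q. cnj (z1 n c q)) p;
           \<zeta>\<^sub>2 = dlog z2 p; \<zeta>\<^sub>2' = dlog (\<lambda>q. cnj (z2 q)) p
       in (\<forall>u v. complex_of_real (gh_metric n c p u v) =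
             1 / V * sym_prod \<zeta>\<^sub>1 \<zeta>\<^sub>1' u v
             - 1 / (2 * V) * H * (sym_prod \<zeta>\<^sub>1 \<zeta>\<^sub>2' u v + sym_prod \<zeta>\<^sub>2 \<zeta>\<^sub>1' u v)
             + (V * \<rho>\<^sup>2 + 1 / (4 * V) * H\<^sup>2) * sym_prod \<zeta>\<^sub>2 \<zeta>\<^sub>2' u v) \<and>
          (\<forall>u v. complex_of_real (gh_omega n c p u v) =
             - (1 / (2 * \<i>)) *
             (1 / V * wedge \<zeta>\<^sub>1 \<zeta>\<^sub>1' u v
              - 1 / (2 * V) * H * (wedge \<zeta>\<^sub>1 \<zeta>\<^sub>2' u v + wedge \<zeta>\<^sub>2 \<zeta>\<^sub>1' u v)
              + (V * \<rho>\<^sup>2 + 1 / (4 * V) * H\<^sup>2) * wedge \<zeta>\<^sub>2 \<zeta>\<^sub>2' u v))))"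
proof (intro conjI ballI impI)
  show "gh_complex_coords n c {p \<in> gh_domain c. rho p > 0} (z1 n c) z2"
    using assms(1) by (intro z1_z2_complex_coords) auto
next
  fix p assume p: "rho p > 0"
  show "let V = complex_of_real (gh_V n c p);
           H = complex_of_real (\<Sum>j=1..n. (rad c j p + zc p - c j) / rad c j p);
           \<rho> = complex_of_real (rho p);
           \<zeta>\<^sub>1 = dlog (z1 n c) p; \<zeta>\<^sub>1' = dlog (\<lambda>q. cnj (z1 n c q)) p;
           \<zeta>\<^sub>2 = dlog z2 p; \<zeta>\<^sub>2' = dlog (\<lambda>q. cnj (z2 q)) p
       in (\<forall>u v. complex_of_real (gh_metric n c p u v) =
             1 / V * sym_prod \<zeta>\<^sub>1 \<zeta>\<^sub>1' u v
             - 1 / (2 * V) * H * (sym_prod \<zeta>\<^sub>1 \<zeta>\<^sub>2' u v + sym_prod \<zeta>\<^sub>2 \<zeta>\<^sub>1' u v)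
             + (V * \<rho>\<^sup>2 + 1 / (4 * V) * H\<^sup>2) * sym_prod \<zeta>\<^sub>2 \<zeta>\<^sub>2' u v) \<and>
          (\<forall>u v. complex_of_real (gh_omega n c p u v) =
             - (1 / (2 * \<i>)) *
             (1 / V * wedge \<zeta>\<^sub>1 \<zeta>\<^sub>1' u v
              - 1 / (2 * V) * H * (wedge \<zeta>\<^sub>1 \<zeta>\<^sub>2' u v + wedge \<zeta>\<^sub>2 \<zeta>\<^sub>1' u v)
              + (V * \<rho>\<^sup>2 + 1 / (4 * V) * H\<^sup>2) * wedge \<zeta>\<^sub>2 \<zeta>\<^sub>2' u v))"
    unfolding Let_def pole_sum_def[symmetric] sym_prod_complete_square wedge_complete_square
      z1_remainder_products[OF assms(1) p] mult.assoc[of _ "(complex_of_real (rho p))\<^sup>2"]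
      z2_products[OF p] gh_metric_def gh_omega_def d_coords
    by (simp add: algebra_simps)
qed

end
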